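(* Let $M$ be a smooth manifold, $F_1,\dots,F_n$ smooth vector fields on $M$, $\alpha_1,\dots,\alpha_n:M\to\mathbb{R}$ smooth functions, and $\sigma$ a permutation of the indices $1,\dots,n$. Then $$D[\alpha_1,\dots,\alpha_n;F_1,\dots,F_n]=D[\alpha_{\sigma(1)},\dots,\alpha_{\sigma(n)};F_{\sigma(1)},\dots,F_{\sigma(n)}].$$
   Context: For a vector field $F$ and a smooth function $\alpha$, $F.\alpha$ is the derivative of $\alpha$ along $F$; in local coordinates $F.\alpha=\langle F,\nabla\alpha\rangle$. With $m=\dim M$, the symbol $D[\alpha_1,\dots,\alpha_n;F_1,\dots,F_n]$ is the function on $M$ defined pointwise by $$D[\alpha_1,\dots,\alpha_n;F_1,\dots,F_n]=\det(E_m+X)=\det(E_n+Y),$$ where $E_k$ is the $k\times k$ identity matrix, $X=\sum_{i=1}^n F_i\,(\nabla\alpha_i)^{t}$ is the $m\times m$ matrix formed in local coordinates from the column vectors $F_i$ and $\nabla\alpha_i$, and $Y$ is the $n\times n$ matrix with $(i,j)$ entry $F_j.\alpha_i$ (the two determinants are equal, and the second shows independence of the coordinates). *)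

theory Defs
  imports
    "HOL-Analysis.Abstract_Euclidean_Space"
    "HOL-Analysis.Derivative"
    "HOL-Combinatorics.Permutations"
    "Jordan_Normal_Form.Determinant"
begin

section \<open>Smooth functions on open subsets of Euclidean space\<close>

text \<open>Points of \<open>m\<close>-dimensional space are the functions \<open>nat \<Rightarrow> real\<close> vanishing from index \<open>m\<close>
  on, i.e. the points of \<open>Euclidean_space m\<close>. This covers every dimension, including \<open>0\<close>.\<close>

definition partial :: "nat \<Rightarrow> ((nat \<Rightarrow> real) \<Rightarrow> real) \<Rightarrow> (nat \<Rightarrow> real) \<Rightarrow> real" where
  "partial i f x = deriv (\<lambda>t. f (x(i := t))) (x i)"

primrec Ck_on :: "nat \<Rightarrow> nat \<Rightarrow> (nat \<Rightarrow> real) set \<Rightarrow> ((nat \<Rightarrow> real) \<Rightarrow> real) \<Rightarrow> bool" where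
  "Ck_on m 0 V f \<longleftrightarrow> continuous_map (subtopology (Euclidean_space m) V) euclideanreal f"
| "Ck_on m (Suc k) V f \<longleftrightarrow>
     continuous_map (subtopology (Euclidean_space m) V) euclideanreal f \<and>
     (\<forall>i<m. (\<forall>x\<in>V. (\<lambda>t. f (x(i := t))) differentiable (at (x i))) \<and> Ck_on m k V (partial i f))"

definition smooth_on :: "nat \<Rightarrow> (nat \<Rightarrow> real) set \<Rightarrow> ((nat \<Rightarrow> real) \<Rightarrow> real) \<Rightarrow> bool" where
  "smooth_on m V f \<longleftrightarrow> (\<forall>k. Ck_on m k V f)"

section \<open>Smooth manifolds\<close>

type_synonym 'a chart = "'a set \<times> ('a \<Rightarrow> nat \<Rightarrow> real)"

record 'a manifold =
  mtop :: "'a topology"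
  mdim :: nat
  atlas :: "'a chart set"

abbreviation points :: "'a manifold \<Rightarrow> 'a set" where
  "points M \<equiv> topspace (mtop M)"

definition chart_inv :: "'a chart \<Rightarrow> (nat \<Rightarrow> real) \<Rightarrow> 'a" where
  "chart_inv c = inv_into (fst c) (snd c)"

definition is_chart :: "'a topology \<Rightarrow> nat \<Rightarrow> 'a chart \<Rightarrow> bool" where
  "is_chart X m c \<longleftrightarrow>
     openin X (fst c) \<and> openin (Euclidean_space m) (snd c ` fst c) \<and>
     homeomorphic_map (subtopology X (fst c))
       (subtopology (Euclidean_space m) (snd c ` fst c)) (snd c)"

text \<open>The atlas is not required to be maximal: it determines the smooth structure, and the
  smooth functions and vector fields below do not depend on which of its atlases is used.\<close>

definition smooth_manifold :: "'a manifold \<Rightarrow> bool" where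
  "smooth_manifold M \<longleftrightarrow>
     Hausdorff_space (mtop M) \<and>
     (\<exists>\<B>. countable \<B> \<and> openin (mtop M) = arbitrary union_of (\<lambda>U. U \<in> \<B>)) \<and>
     (\<forall>c\<in>atlas M. is_chart (mtop M) (mdim M) c) \<and>
     (\<Union>c\<in>atlas M. fst c) = points M \<and>
     (\<forall>c\<in>atlas M. \<forall>d\<in>atlas M. \<forall>k<mdim M.
        smooth_on (mdim M) (snd c ` (fst c \<inter> fst d)) (\<lambda>x. snd d (chart_inv c x) k))"

definition smooth_function :: "'a manifold \<Rightarrow> ('a \<Rightarrow> real) \<Rightarrow> bool" where
  "smooth_function M \<alpha> \<longleftrightarrow>
     (\<forall>c\<in>atlas M. smooth_on (mdim M) (snd c ` fst c) (\<lambda>x. \<alpha> (chart_inv c x)))"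

text \<open>A vector field is given by its local coordinates: \<open>F c p k\<close> is the \<open>k\<close>-th component at \<open>p\<close>
  with respect to the chart \<open>c\<close>. Components in overlapping charts are related by the Jacobian
  matrix of the change of coordinates.\<close>

type_synonym 'a vfield = "'a chart \<Rightarrow> 'a \<Rightarrow> nat \<Rightarrow> real"

definition smooth_vector_field :: "'a manifold \<Rightarrow> 'a vfield \<Rightarrow> bool" where
  "smooth_vector_field M F \<longleftrightarrow>
     (\<forall>c\<in>atlas M. \<forall>k<mdim M.
        smooth_on (mdim M) (snd c ` fst c) (\<lambda>x. F c (chart_inv c x) k)) \<and>
     (\<forall>c\<in>atlas M. \<forall>d\<in>atlas M. \<forall>p\<in>fst c \<inter> fst d. \<forall>k<mdim M.
        F d p k = (\<Sum>l<mdim M. partial l (\<lambda>x. snd d (chart_inv c x) k) (snd c p) * F c p l))"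

definition gradient :: "'a chart \<Rightarrow> ('a \<Rightarrow> real) \<Rightarrow> 'a \<Rightarrow> nat \<Rightarrow> real" where
  "gradient c \<alpha> p k = partial k (\<lambda>x. \<alpha> (chart_inv c x)) (snd c p)"

text \<open>The derivative of \<open>\<alpha>\<close> along \<open>F\<close>. Any chart around \<open>p\<close> gives the same value; see
  \<open>derivative_along_chart\<close> below.\<close>

definition derivative_along :: "'a manifold \<Rightarrow> 'a vfield \<Rightarrow> ('a \<Rightarrow> real) \<Rightarrow> 'a \<Rightarrow> real" where
  "derivative_along M F \<alpha> p =
     (let c = (SOME c. c \<in> atlas M \<and> p \<in> fst c)
      in \<Sum>k<mdim M. F c p k * gradient c \<alpha> p k)"

section \<open>The function \<open>D\<close>\<close>

text \<open>Indices run over \<open>{..<n}\<close> instead of \<open>1, \<dots>, n\<close>. The definition is the expression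
  \<open>det (E + Y)\<close>, which mentions no chart; \<open>D_det_chart\<close> below shows that \<open>det (E + X)\<close>,
  computed in an arbitrary chart, has the same value.\<close>

definition D_det :: "'a manifold \<Rightarrow> nat \<Rightarrow> (nat \<Rightarrow> 'a \<Rightarrow> real) \<Rightarrow> (nat \<Rightarrow> 'a vfield) \<Rightarrow> 'a \<Rightarrow> real" where
  "D_det M n \<alpha> F p =
     det (1\<^sub>m n + mat n n (\<lambda>(i, j). derivative_along M (F j) (\<alpha> i) p))"

section \<open>Independence of the chart\<close>

lemma topspace_sub_Euclidean:
  assumes "openin (Euclidean_space m) V"
  shows "topspace (subtopology (Euclidean_space m) V) = V"
  using openin_subset[OF assms] by (auto simp: topspace_subtopology)

lemma Euclidean_box:
  assumes V: "openin (Euclidean_space m) V" and x: "x \<in> V"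
  obtains e where "e > 0"
    "\<And>y. \<lbrakk>\<And>i. i \<ge> m \<Longrightarrow> y i = 0; \<And>i. i < m \<Longrightarrow> \<bar>y i - x i\<bar> < e\<rbrakk> \<Longrightarrow> y \<in> V"
proof -
  obtain T where T: "openin (powertop_real UNIV) T" "V = T \<inter> {x. \<forall>i\<ge>m. x i = 0}"
    using V unfolding Euclidean_space_def openin_subtopology by blast
  have xT: "x \<in> T" and x0: "\<And>i. i \<ge> m \<Longrightarrow> x i = 0" using x T by auto
  obtain X where X: "x \<in> PiE UNIV X" "\<And>i. openin euclideanreal (X i)" "PiE UNIV X \<subseteq> T"
    using product_topology_open_contains_basis[OF T(1) xT] by blast
  have "\<exists>r>0. \<forall>z. \<bar>z - x i\<bar> < r \<longrightarrow> z \<in> X i" for i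
  proof -
    have "open (X i)" "x i \<in> X i" using X(1,2) by (auto simp: PiE_iff)
    then show ?thesis by (auto simp: open_dist dist_real_def)
  qed
  then obtain r where r: "\<And>i. r i > 0" "\<And>i z. \<bar>z - x i\<bar> < r i \<Longrightarrow> z \<in> X i" by metis
  define e where "e = Min (insert 1 (r ` {..<m}))"
  have e: "e > 0" "\<And>i. i < m \<Longrightarrow> e \<le> r i" using r(1) by (auto simp: e_def)
  have "y \<in> V" if y: "\<And>i. i \<ge> m \<Longrightarrow> y i = 0" "\<And>i. i < m \<Longrightarrow> \<bar>y i - x i\<bar> < e" for y
  proof -
    have "y i \<in> X i" for i
    proof (cases "i < m")
      case True then show ?thesis using e(2)[OF True] y(2)[OF True] by (intro r(2)) linarith
    next
      case False then show ?thesis using y(1)[of i] x0[of i] r(1)[of i] by (intro r(2)) simp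
    qed
    then have "y \<in> T" using X(3) by (auto simp: PiE_iff)
    then show ?thesis using T y by auto
  qed
  with e(1) that show ?thesis by blast
qed

lemma mvt_unordered:
  fixes u :: "real \<Rightarrow> real"
  assumes "\<And>s. \<bar>s - a\<bar> \<le> \<bar>b - a\<bar> \<Longrightarrow> (u has_real_derivative u' s) (at s)"
  shows "\<exists>s. \<bar>s - a\<bar> \<le> \<bar>b - a\<bar> \<and> u b - u a = (b - a) * u' s"
proof (cases a b rule: linorder_cases)
  case less
  then obtain z where "a < z" "z < b" "u b - u a = (b - a) * u' z"
    using MVT2[of a b u u'] assms by auto
  then show ?thesis by (intro exI[of _ z]) auto
next
  case equal then show ?thesis by auto
next
  case greater
  then obtain z where z: "b < z" "z < a" "u a - u b = (a - b) * u' z"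
    using MVT2[of b a u u'] assms by auto
  then have "u b - u a = (b - a) * u' z" by (simp add: algebra_simps)
  then show ?thesis using z by (intro exI[of _ z]) auto
qed

lemma Ck_on_Suc_0_partial:
  assumes f: "Ck_on m (Suc 0) V f" and "k < m" "y(k := s) \<in> V"
  shows "((\<lambda>t. f (y(k := t))) has_real_derivative partial k f (y(k := s))) (at s)"
proof -
  have "(\<lambda>t. f ((y(k := s))(k := t))) differentiable (at ((y(k := s)) k))"
    using assms unfolding Ck_on.simps by blast
  then have "(\<lambda>t. f (y(k := t))) field_differentiable (at s)"
    by (simp add: field_differentiable_def real_differentiable_def)
  then show ?thesis
    by (simp add: partial_def DERIV_deriv_iff_field_differentiable)
qed

lemma chain_rule_partial:
  assumes V: "openin (Euclidean_space m) V" and f: "Ck_on m (Suc 0) V f"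
    and x: "\<gamma> t0 \<in> V"
    and g: "\<And>k. k < m \<Longrightarrow> ((\<lambda>t. \<gamma> t k) has_real_derivative g k) (at t0)"
    and g0: "\<forall>\<^sub>F t in at t0. \<forall>i\<ge>m. \<gamma> t i = 0"
  shows "((\<lambda>t. f (\<gamma> t)) has_real_derivative (\<Sum>k<m. partial k f (\<gamma> t0) * g k)) (at t0)"
proof -
  define x where "x = \<gamma> t0"
  define h where "h = (\<lambda>k t i. if i < k then \<gamma> t i else x i)"
  have xV: "x \<in> V" using x by (simp add: x_def)
  have x0: "x i = 0" if "i \<ge> m" for i
    using openin_subset[OF V] xV that by (auto simp: topspace_Euclidean_space)
  have near: "\<forall>\<^sub>F t in at t0. (\<forall>i\<ge>m. \<gamma> t i = 0) \<and> (\<forall>i\<in>{..<m}. \<bar>\<gamma> t i - x i\<bar> < e)"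
    if "e > 0" for e
  proof (intro eventually_conj g0 eventually_ball_finite ballI)
    fix i assume "i \<in> {..<m}"
    then have "((\<lambda>t. \<gamma> t i) \<longlongrightarrow> \<gamma> t0 i) (at t0)"
      using DERIV_isCont[OF g] by (auto simp: isCont_def)
    from tendstoD[OF this that] show "\<forall>\<^sub>F t in at t0. \<bar>\<gamma> t i - x i\<bar> < e"
      by (simp add: dist_real_def x_def)
  qed simp
  have hS: "h (Suc k) t = (h k t)(k := \<gamma> t k)" and hk: "h k t k = x k" for k t
    by (auto simp: h_def)
  have hself: "h k t = (h k t)(k := x k)" for k t by (auto simp: h_def)
  obtain e0 where e0: "e0 > 0"
    "\<And>y. \<lbrakk>\<And>i. i \<ge> m \<Longrightarrow> y i = 0; \<And>i. i < m \<Longrightarrow> \<bar>y i - x i\<bar> < e0\<rbrakk> \<Longrightarrow> y \<in> V"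
    using Euclidean_box[OF V xV] by blast
  have step: "((\<lambda>t. (f (h (Suc k) t) - f (h k t)) / (t - t0)) \<longlongrightarrow> partial k f x * g k) (at t0)"
    if k: "k < m" for k
  proof -
    define q where "q = (\<lambda>t. if \<gamma> t k = x k then partial k f x
                            else (f (h (Suc k) t) - f (h k t)) / (\<gamma> t k - x k))"
    have qlim: "(q \<longlongrightarrow> partial k f x) (at t0)"
    proof (rule tendstoI)
      fix r :: real assume r: "r > 0"
      let ?E = "subtopology (Euclidean_space m) V"
      have "continuous_map ?E euclideanreal (partial k f)"
        using f k by auto
      then have "openin ?E {y \<in> topspace ?E. partial k f y \<in> ball (partial k f x) r}"
        by (intro openin_continuous_map_preimage[of _ euclideanreal]) auto
      then have "openin (Euclidean_space m) {y \<in> V. partial k f y \<in> ball (partial k f x) r}"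
        unfolding topspace_sub_Euclidean[OF V] using openin_trans_full[OF _ V] by blast
      moreover have "x \<in> {y \<in> V. partial k f y \<in> ball (partial k f x) r}" using xV r by simp
      ultimately obtain e where e: "e > 0"
        "\<And>y. \<lbrakk>\<And>i. i \<ge> m \<Longrightarrow> y i = 0; \<And>i. i < m \<Longrightarrow> \<bar>y i - x i\<bar> < e\<rbrakk>
             \<Longrightarrow> y \<in> {y \<in> V. partial k f y \<in> ball (partial k f x) r}"
        using Euclidean_box by blast
      show "\<forall>\<^sub>F t in at t0. dist (q t) (partial k f x) < r"
        using near[OF e(1)]
      proof eventually_elim
        case (elim t)
        have pt: "(h k t)(k := s) \<in> {y \<in> V. partial k f y \<in> ball (partial k f x) r}"
          if "\<bar>s - x k\<bar> \<le> \<bar>\<gamma> t k - x k\<bar>" for s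
        proof (rule e(2))
          fix i assume "i \<ge> m"
          then show "((h k t)(k := s)) i = 0" using k x0 by (auto simp: h_def)
        next
          fix i assume i: "i < m"
          have "\<bar>\<gamma> t k - x k\<bar> < e" "\<bar>\<gamma> t i - x i\<bar> < e" using elim i k by auto
          then show "\<bar>((h k t)(k := s)) i - x i\<bar> < e" using that e(1) by (auto simp: h_def)
        qed
        have "\<exists>s. \<bar>s - x k\<bar> \<le> \<bar>\<gamma> t k - x k\<bar> \<and>
           f ((h k t)(k := \<gamma> t k)) - f ((h k t)(k := x k)) =
             (\<gamma> t k - x k) * partial k f ((h k t)(k := s))"
          by (rule mvt_unordered, rule Ck_on_Suc_0_partial[OF f k]) (use pt in auto)
        then obtain s where s: "\<bar>s - x k\<bar> \<le> \<bar>\<gamma> t k - x k\<bar>"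
          "f (h (Suc k) t) - f (h k t) = (\<gamma> t k - x k) * partial k f ((h k t)(k := s))"
          unfolding hS using hself by metis
        show ?case
        proof (cases "\<gamma> t k = x k")
          case False
          then have "q t = partial k f ((h k t)(k := s))" using s(2) by (simp add: q_def)
          then show ?thesis using pt[OF s(1)] by (simp add: dist_commute)
        qed (use r in \<open>simp add: q_def\<close>)
      qed
    qed
    have "((\<lambda>t. (\<gamma> t k - x k) / (t - t0)) \<longlongrightarrow> g k) (at t0)"
      using g[OF k] by (simp add: has_field_derivative_iff x_def)
    from tendsto_mult[OF qlim this]
    have "((\<lambda>t. q t * ((\<gamma> t k - x k) / (t - t0))) \<longlongrightarrow> partial k f x * g k) (at t0)" .
    moreover have "q t * ((\<gamma> t k - x k) / (t - t0)) = (f (h (Suc k) t) - f (h k t)) / (t - t0)" for t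
    proof (cases "\<gamma> t k = x k")
      case True
      then have "h (Suc k) t = h k t" using hS hself by metis
      then show ?thesis using True by simp
    qed (simp add: q_def)
    ultimately show ?thesis by (simp only:)
  qed
  have "((\<lambda>t. \<Sum>k<m. (f (h (Suc k) t) - f (h k t)) / (t - t0)) \<longlongrightarrow> (\<Sum>k<m. partial k f x * g k)) (at t0)"
    by (intro tendsto_sum step) auto
  moreover have "\<forall>\<^sub>F t in at t0. (\<Sum>k<m. (f (h (Suc k) t) - f (h k t)) / (t - t0))
      = (f (\<gamma> t) - f (\<gamma> t0)) / (t - t0)"
    using g0
  proof eventually_elim
    case (elim t)
    have "h m t = \<gamma> t" using elim x0 by (auto simp: h_def fun_eq_iff)
    moreover have "h 0 t = \<gamma> t0" by (simp add: h_def x_def)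
    moreover have "(\<Sum>k<m. f (h (Suc k) t) - f (h k t)) = f (h m t) - f (h 0 t)"
      by (rule sum_lessThan_telescope)
    ultimately show ?case by (simp flip: sum_divide_distrib)
  qed
  ultimately have "((\<lambda>t. (f (\<gamma> t) - f (\<gamma> t0)) / (t - t0)) \<longlongrightarrow> (\<Sum>k<m. partial k f x * g k)) (at t0)"
    using tendsto_cong by fast
  then show ?thesis by (simp add: has_field_derivative_iff x_def)
qed

lemma chart_inv_left:
  assumes "is_chart X m c" "p \<in> fst c" shows "chart_inv c (snd c p) = p"
proof -
  have "inj_on (snd c) (fst c)"
    using assms(1) openin_subset[of X "fst c"]
    by (auto simp: is_chart_def homeomorphic_eq_everything_map topspace_subtopology Int_absorb1)
  then show ?thesis using assms(2) by (simp add: chart_inv_def)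
qed

lemma openin_chart_image:
  assumes c: "is_chart X m c" and W: "openin X W"
  shows "openin (Euclidean_space m) (snd c ` (fst c \<inter> W))"
proof -
  have "openin (subtopology X (fst c)) (fst c \<inter> W)"
    using W by (auto simp: openin_subtopology)
  then have "openin (subtopology (Euclidean_space m) (snd c ` fst c)) (snd c ` (fst c \<inter> W))"
    using c homeomorphic_map_openness_eq unfolding is_chart_def by blast
  then show ?thesis using c openin_trans_full unfolding is_chart_def by blast
qed

lemma gradient_change_of_chart:
  assumes M: "smooth_manifold M" and \<alpha>: "smooth_function M \<alpha>"
    and c: "c \<in> atlas M" "p \<in> fst c" and d: "d \<in> atlas M" "p \<in> fst d" and l: "l < mdim M"
  shows "gradient c \<alpha> p l =
    (\<Sum>k<mdim M. gradient d \<alpha> p k * partial l (\<lambda>x. snd d (chart_inv c x) k) (snd c p))"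
proof -
  let ?m = "mdim M" and ?x = "snd c p"
  let ?U = "fst c \<inter> fst d"
  let ?\<gamma> = "\<lambda>t. snd d (chart_inv c (?x(l := t)))"
  have cc: "is_chart (mtop M) ?m c" and cd: "is_chart (mtop M) ?m d"
    using M c d by (auto simp: smooth_manifold_def)
  have oW: "openin (Euclidean_space ?m) (snd c ` ?U)"
    using openin_chart_image[OF cc] cd by (simp add: is_chart_def)
  have oV: "openin (Euclidean_space ?m) (snd d ` fst d)" using cd by (simp add: is_chart_def)
  have xW: "?x \<in> snd c ` ?U" using c d by auto
  have x\<gamma>: "?\<gamma> (?x l) = snd d p" using chart_inv_left[OF cc c(2)] by simp
  obtain e where e: "e > 0"
    "\<And>y. \<lbrakk>\<And>i. i \<ge> ?m \<Longrightarrow> y i = 0; \<And>i. i < ?m \<Longrightarrow> \<bar>y i - ?x i\<bar> < e\<rbrakk> \<Longrightarrow> y \<in> snd c ` ?U"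
    using Euclidean_box[OF oW xW] by blast
  have x0: "?x i = 0" if "i \<ge> ?m" for i
    using openin_subset[OF oW] xW that by (auto simp: topspace_Euclidean_space)
  have inW: "?x(l := t) \<in> snd c ` ?U" if "\<bar>t - ?x l\<bar> < e" for t
    by (rule e(2)) (use that l x0 e(1) in auto)
  have "\<forall>\<^sub>F t in nhds (?x l). \<bar>t - ?x l\<bar> < e"
    unfolding eventually_nhds_metric dist_real_def using e(1) by blast
  then have evW: "\<forall>\<^sub>F t in nhds (?x l). ?x(l := t) \<in> snd c ` ?U"
    by (rule eventually_mono) (rule inW)
  have inU: "chart_inv c y \<in> ?U" if "y \<in> snd c ` ?U" for y
    using that chart_inv_left[OF cc] by auto
  have g: "((\<lambda>t. ?\<gamma> t k) has_real_derivative
      partial l (\<lambda>x. snd d (chart_inv c x) k) ?x) (at (?x l))" if "k < ?m" for k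
  proof -
    have "Ck_on ?m (Suc 0) (snd c ` ?U) (\<lambda>x. snd d (chart_inv c x) k)"
      using M c d that by (auto simp: smooth_manifold_def smooth_on_def simp del: Ck_on.simps)
    from Ck_on_Suc_0_partial[OF this l, of ?x "?x l"] xW show ?thesis by simp
  qed
  have "((\<lambda>t. \<alpha> (chart_inv d (?\<gamma> t))) has_real_derivative
     (\<Sum>k<?m. partial k (\<lambda>x. \<alpha> (chart_inv d x)) (?\<gamma> (?x l)) *
        partial l (\<lambda>x. snd d (chart_inv c x) k) ?x)) (at (?x l))"
  proof (rule chain_rule_partial[OF oV _ _ g])
    show "Ck_on ?m (Suc 0) (snd d ` fst d) (\<lambda>x. \<alpha> (chart_inv d x))"
      using \<alpha> d by (auto simp: smooth_function_def smooth_on_def simp del: Ck_on.simps)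
    show "?\<gamma> (?x l) \<in> snd d ` fst d" using x\<gamma> d by auto
    have "\<forall>\<^sub>F t in at (?x l). ?x(l := t) \<in> snd c ` ?U"
      using evW by (simp add: eventually_nhds_conv_at)
    then show "\<forall>\<^sub>F t in at (?x l). \<forall>i\<ge>?m. ?\<gamma> t i = 0"
    proof eventually_elim
      case (elim t)
      from inU[OF elim] have "?\<gamma> t \<in> snd d ` fst d" by auto
      then have "?\<gamma> t \<in> topspace (Euclidean_space ?m)" using openin_subset[OF oV] by blast
      then show ?case unfolding topspace_Euclidean_space by blast
    qed
  qed
  moreover have "\<forall>\<^sub>F t in nhds (?x l). \<alpha> (chart_inv d (?\<gamma> t)) = \<alpha> (chart_inv c (?x(l := t)))"
    using evW
  proof eventually_elim
    case (elim t)
    then show ?case using chart_inv_left[OF cd] inU[OF elim] by auto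
  qed
  ultimately have "((\<lambda>t. \<alpha> (chart_inv c (?x(l := t)))) has_real_derivative
     (\<Sum>k<?m. gradient d \<alpha> p k * partial l (\<lambda>x. snd d (chart_inv c x) k) ?x)) (at (?x l))"
    unfolding x\<gamma> gradient_def using DERIV_cong_ev by fast
  then show ?thesis
    unfolding gradient_def[of c] partial_def[of l "\<lambda>x. \<alpha> (chart_inv c x)"] by (rule DERIV_imp_deriv)
qed

lemma derivative_along_chart:
  assumes M: "smooth_manifold M" and \<alpha>: "smooth_function M \<alpha>" and F: "smooth_vector_field M F"
    and c: "c \<in> atlas M" "p \<in> fst c"
  shows "derivative_along M F \<alpha> p = (\<Sum>k<mdim M. F c p k * gradient c \<alpha> p k)"
proof -
  define d where "d = (SOME c. c \<in> atlas M \<and> p \<in> fst c)"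
  have d: "d \<in> atlas M" "p \<in> fst d"
    using someI[of "\<lambda>c. c \<in> atlas M \<and> p \<in> fst c" c] c by (auto simp: d_def)
  let ?J = "\<lambda>k l. partial l (\<lambda>x. snd d (chart_inv c x) k) (snd c p)"
  have "derivative_along M F \<alpha> p = (\<Sum>k<mdim M. F d p k * gradient d \<alpha> p k)"
    by (simp add: derivative_along_def d_def Let_def)
  also have "\<dots> = (\<Sum>k<mdim M. (\<Sum>l<mdim M. ?J k l * F c p l) * gradient d \<alpha> p k)"
    using F c d by (intro sum.cong refl) (auto simp: smooth_vector_field_def)
  also have "\<dots> = (\<Sum>k<mdim M. \<Sum>l<mdim M. F c p l * (gradient d \<alpha> p k * ?J k l))"
    by (simp add: sum_distrib_left sum_distrib_right mult_ac)
  also have "\<dots> = (\<Sum>l<mdim M. \<Sum>k<mdim M. F c p l * (gradient d \<alpha> p k * ?J k l))"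
    by (rule sum.swap)
  also have "\<dots> = (\<Sum>l<mdim M. F c p l * gradient c \<alpha> p l)"
    using gradient_change_of_chart[OF M \<alpha> c d] by (simp add: sum_distrib_left)
  finally show ?thesis .
qed

lemma det_one_add_mult_commute:
  fixes A B :: "'a :: idom mat"
  assumes A: "A \<in> carrier_mat m n" and B: "B \<in> carrier_mat n m"
  shows "det (1\<^sub>m m + A * B) = det (1\<^sub>m n + B * A)"
proof -
  let ?P = "four_block_mat (1\<^sub>m m) (- A) B (1\<^sub>m n)"
  let ?L = "four_block_mat (1\<^sub>m m) (0\<^sub>m m n) (- B) (1\<^sub>m n)"
  let ?R = "four_block_mat (1\<^sub>m m) A (0\<^sub>m n m) (1\<^sub>m n)"
  note carr = A B uminus_carrier_mat[OF A] uminus_carrier_mat[OF B] one_carrier_mat zero_carrier_mat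
  have P: "?P \<in> carrier_mat (m + n) (m + n)" and L: "?L \<in> carrier_mat (m + n) (m + n)"
    and R: "?R \<in> carrier_mat (m + n) (m + n)"
    using carr by auto
  have dL: "det ?L = 1"
    using det_four_block_mat_upper_right_zero[of "1\<^sub>m m" m "0\<^sub>m m n" n "- B" "1\<^sub>m n"] carr by simp
  have dR: "det ?R = 1"
    using det_four_block_mat_lower_left_zero[of "1\<^sub>m m" m A n "0\<^sub>m n m" "1\<^sub>m n"] carr by simp
  have BA: "B * A \<in> carrier_mat n n" and AB: "A * B \<in> carrier_mat m m" using A B by auto
  have "?L * ?P = four_block_mat (1\<^sub>m m) (- A) (0\<^sub>m n m) (1\<^sub>m n + B * A)"
    by (subst mult_four_block_mat[of _ m m _ n _ n _ _ m _ n])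
      (use carr BA in \<open>auto intro!: arg_cong2[where f = "\<lambda>x y. four_block_mat _ _ x y"]
        simp: comm_add_mat uminus_l_inv_mat\<close>)
  then have "det (?L * ?P) = det (1\<^sub>m n + B * A)"
    using det_four_block_mat_lower_left_zero[of "1\<^sub>m m" m "- A" n "0\<^sub>m n m" "1\<^sub>m n + B * A"] carr BA
    by simp
  then have 1: "det ?P = det (1\<^sub>m n + B * A)"
    using det_mult[OF L P] dL by simp
  have "?R * ?P = four_block_mat (1\<^sub>m m + A * B) (0\<^sub>m m n) B (1\<^sub>m n)"
    by (subst mult_four_block_mat[of _ m m _ n _ n _ _ m _ n])
      (use carr AB in \<open>auto simp: uminus_l_inv_mat\<close>)
  then have "det (?R * ?P) = det (1\<^sub>m m + A * B)"
    using det_four_block_mat_upper_right_zero[of "1\<^sub>m m + A * B" m "0\<^sub>m m n" n B "1\<^sub>m n"] carr AB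
    by simp
  then have "det ?P = det (1\<^sub>m m + A * B)"
    using det_mult[OF R P] dR by simp
  with 1 show ?thesis by simp
qed

lemma D_det_chart:
  assumes M: "smooth_manifold M"
    and \<alpha>: "\<And>i. i < n \<Longrightarrow> smooth_function M (\<alpha> i)"
    and F: "\<And>i. i < n \<Longrightarrow> smooth_vector_field M (F i)"
    and c: "c \<in> atlas M" "p \<in> fst c"
  shows "D_det M n \<alpha> F p = det (1\<^sub>m (mdim M) +
    mat (mdim M) (mdim M) (\<lambda>(k, l). \<Sum>i<n. F i c p k * gradient c (\<alpha> i) p l))"
proof -
  let ?m = "mdim M"
  define A where "A = mat ?m n (\<lambda>(k, i). F i c p k)"
  define B where "B = mat n ?m (\<lambda>(i, l). gradient c (\<alpha> i) p l)"
  have AB: "A \<in> carrier_mat ?m n" "B \<in> carrier_mat n ?m" by (simp_all add: A_def B_def)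
  have "mat ?m ?m (\<lambda>(k, l). \<Sum>i<n. F i c p k * gradient c (\<alpha> i) p l) = A * B"
    by (rule eq_matI) (auto simp: A_def B_def scalar_prod_def atLeast0LessThan)
  moreover have "mat n n (\<lambda>(i, j). derivative_along M (F j) (\<alpha> i) p) = B * A"
    by (rule eq_matI) (auto simp: A_def B_def scalar_prod_def atLeast0LessThan
        derivative_along_chart[OF M \<alpha> F c] mult.commute)
  ultimately show ?thesis
    unfolding D_det_def using det_one_add_mult_commute[OF AB] by simp
qed

end

theory Submission
  imports Defs
begin

text \<open>In a chart \<open>c\<close> around \<open>p\<close>, \<open>D\<close> is \<open>det (E + X)\<close>, where \<open>X\<close> is the sum of the rank-one matrices
  \<open>F\<^sub>i (\<nabla>\<alpha>\<^sub>i)\<^sup>t\<close>. A simultaneous permutation of the \<open>F\<^sub>i\<close> and the \<open>\<alpha>\<^sub>i\<close> only reorders the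
  summands, so \<open>X\<close> itself does not change. By contrast, the chart-free matrix \<open>Y\<close> does change: its rows
  and columns are permuted, and one would have to cancel two signs of \<open>\<sigma>\<close>.\<close>

theorem lemma2p4p1:
  fixes M :: "'a manifold" and n :: nat
    and \<alpha> :: "nat \<Rightarrow> 'a \<Rightarrow> real" and F :: "nat \<Rightarrow> 'a vfield" and \<sigma> :: "nat \<Rightarrow> nat"
  assumes "smooth_manifold M"
    and "\<And>i. i < n \<Longrightarrow> smooth_vector_field M (F i)"
    and "\<And>i. i < n \<Longrightarrow> smooth_function M (\<alpha> i)"
    and "\<sigma> permutes {..<n}"
  shows "\<forall>p\<in>points M. D_det M n \<alpha> F p = D_det M n (\<lambda>i. \<alpha> (\<sigma> i)) (\<lambda>i. F (\<sigma> i)) p"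
proof
  fix p assume "p \<in> points M"
  then obtain c where c: "c \<in> atlas M" "p \<in> fst c"
    using assms(1) unfolding smooth_manifold_def by blast
  have \<sigma>: "\<sigma> i < n" if "i < n" for i
    using permutes_in_image[OF assms(4), of i] that by simp
  have "(\<Sum>i<n. F i c p k * gradient c (\<alpha> i) p l) =
      (\<Sum>i<n. F (\<sigma> i) c p k * gradient c (\<alpha> (\<sigma> i)) p l)" for k l
    using sum.permute[OF assms(4), of "\<lambda>i. F i c p k * gradient c (\<alpha> i) p l"]
    by (simp add: o_def)
  moreover have "D_det M n (\<lambda>i. \<alpha> (\<sigma> i)) (\<lambda>i. F (\<sigma> i)) p = det (1\<^sub>m (mdim M) +
      mat (mdim M) (mdim M) (\<lambda>(k, l). \<Sum>i<n. F (\<sigma> i) c p k * gradient c (\<alpha> (\<sigma> i)) p l))"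
    using assms(2,3) \<sigma> by (intro D_det_chart[OF assms(1) _ _ c]) auto
  ultimately show "D_det M n \<alpha> F p = D_det M n (\<lambda>i. \<alpha> (\<sigma> i)) (\<lambda>i. F (\<sigma> i)) p"
    by (simp add: D_det_chart[OF assms(1,3,2) c])
qed

end
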